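(* Let $k\ge 2$ be an integer and let $a,b,c\in\mathbb{Z}[\tau]\setminus\{0\}$ satisfy $a^k+b^k=c^k$. Then there exists $N\in\mathbb{Z}$ such that for every $n\in\mathbb{Z}$, the three elements $a\tau^n,\ b\tau^n,\ c\tau^n$ all lie in the Fibonacci model set $\Lambda$ if and only if $n\ge N$.
   Context: $\tau=\frac{1+\sqrt5}{2}$, $\tau'=\frac{1-\sqrt5}{2}$, and $\mathbb{Z}[\tau]=\{m+n\tau \mid m,n\in\mathbb{Z}\}$. Since $\tau\tau'=-1$, $\tau$ is a unit of $\mathbb{Z}[\tau]$, so $\tau^n\in\mathbb{Z}[\tau]$ for all $n\in\mathbb{Z}$. The Galois conjugation $\sigma:\mathbb{Z}[\tau]\to\mathbb{Z}[\tau]$ is $\sigma(m+n\tau)=m+n\tau'$ for $m,n\in\mathbb{Z}$. The Fibonacci model set is $\Lambda=\{x\in\mathbb{Z}[\tau] \mid \sigma(x)\in[-1,\tau-1)\}$, the half-open interval being taken in $\mathbb{R}$. *)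

theory Defs
  imports Complex_Main "HOL-Computational_Algebra.Computational_Algebra"
begin

definition tau :: real where
  "tau = (1 + sqrt 5) / 2"

definition tau' :: real where
  "tau' = (1 - sqrt 5) / 2"

definition Z_tau :: "real set" where
  "Z_tau = {of_int m + of_int n * tau | m n :: int. True}"

text \<open>The Galois conjugation is meaningful on \<open>Z_tau\<close> only; it is well defined there because
  the representation \<open>x = m + n \<tau>\<close> is unique (lemma \<open>galois_conj_eq\<close>).\<close>

definition galois_conj :: "real \<Rightarrow> real" where
  "galois_conj x =
     (THE y. \<exists>m n :: int. x = of_int m + of_int n * tau \<and> y = of_int m + of_int n * tau')"

definition fib_model_set :: "real set" where
  "fib_model_set = {x \<in> Z_tau. galois_conj x \<in> {-1..<tau - 1}}"

lemma int_square_eq_5_square: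
  fixes p q :: int
  assumes "p\<^sup>2 = 5 * q\<^sup>2"
  shows "q = 0"
proof (rule ccontr)
  assume q: "q \<noteq> 0"
  with assms have p: "p \<noteq> 0" by auto
  have pr: "prime (5 :: int)" by simp
  have "multiplicity 5 (p\<^sup>2) = 2 * multiplicity 5 p"
    using p pr by (simp add: prime_elem_multiplicity_power_distrib)
  moreover have "multiplicity 5 (5 * q\<^sup>2) = Suc (2 * multiplicity 5 q)"
    using q pr by (simp add: prime_elem_multiplicity_power_distrib multiplicity_times_same)
  ultimately have "2 * multiplicity 5 p = Suc (2 * multiplicity 5 q)"
    using assms by simp
  then show False by presburger
qed

lemma Z_tau_repr_unique:
  fixes m n m' n' :: int
  assumes "of_int m + of_int n * tau = of_int m' + of_int n' * tau"
  shows "m = m' \<and> n = n'"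
proof -
  define p where "p = 2 * (m' - m) + (n' - n)"
  define q where "q = n - n'"
  have "real_of_int p = of_int q * sqrt 5"
    using assms by (simp add: p_def q_def tau_def field_simps)
  then have "(real_of_int p)\<^sup>2 = of_int q ^ 2 * 5"
    by (simp add: power_mult_distrib)
  then have "real_of_int (p\<^sup>2) = of_int (5 * q\<^sup>2)"
    by simp
  then have "p\<^sup>2 = 5 * q\<^sup>2"
    by (simp only: of_int_eq_iff)
  then have "q = 0" by (rule int_square_eq_5_square)
  then show ?thesis using assms by (simp add: q_def)
qed

lemma galois_conj_eq:
  "galois_conj (of_int m + of_int n * tau) = of_int m + of_int n * tau'"
  unfolding galois_conj_def
  by (rule the_equality) (use Z_tau_repr_unique in blast)+

end

theory Submission
  imports Defs
begin

text \<open>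
  Conjugation turns multiplication by \<open>\<tau>\<close> into multiplication by \<open>\<tau>'\<close>, which contracts the window
  \<open>[-1, \<tau> - 1)\<close> into itself except that its endpoint \<open>-1\<close> is sent to the excluded endpoint
  \<open>\<tau> - 1\<close>. So it suffices that no member of a Fermat triple in \<open>\<Lambda>\<close> has conjugate \<open>-1\<close>, that is,
  equals \<open>-1\<close>. For even \<open>k\<close> this follows from size considerations in both embeddings, as the norm
  of a nonzero element has absolute value at least \<open>1\<close>. For odd \<open>k\<close> one gets
  \<open>A\<^sup>k + B\<^sup>k = 1\<close> with conjugates \<open>A', B'\<close> in \<open>(0, 1)\<close>. Then \<open>A + B\<close> divides \<open>1\<close> and is positive in
  both embeddings, so its norm is \<open>1\<close>; its conjugate \<open>t\<close> lies in \<open>(1, 2)\<close>, and its trace \<open>t + 1/t\<close>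
  would be an integer strictly between \<open>2\<close> and \<open>5/2\<close>.
\<close>

section \<open>Conjugate pairs: ring operations, trace and norm\<close>

text \<open>A relational form of \<open>galois_conj\<close>: pairs can be added and multiplied
  without evaluating the \<open>THE\<close>.\<close>

definition conj_pair :: "real \<Rightarrow> real \<Rightarrow> bool" where
  "conj_pair x y \<longleftrightarrow> (\<exists>m n :: int. x = of_int m + of_int n * tau \<and> y = of_int m + of_int n * tau')"

lemma tau_squared: "tau * tau = 1 + tau"
  and tau'_squared: "tau' * tau' = 1 + tau'"
  and tau_mult_tau': "tau * tau' = - 1"
  and tau_add_tau': "tau + tau' = 1"
  by (simp_all add: tau_def tau'_def field_simps)

lemma tau_gt_1: "1 < tau" and tau_less_2: "tau < 2"
proof -
  have "1 < sqrt 5" "sqrt 5 < 3" by (simp_all add: real_less_lsqrt)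
  then show "1 < tau" "tau < 2" by (simp_all add: tau_def)
qed

lemma tau'_eq: "tau' = 1 - tau"
  using tau_add_tau' by simp

lemma conj_pair_of_int: "conj_pair (of_int m) (of_int m)"
  unfolding conj_pair_def by (rule exI[of _ m], rule exI[of _ 0]) simp

lemma conj_pair_1: "conj_pair 1 1"
  using conj_pair_of_int[of 1] by simp

lemma conj_pair_tau: "conj_pair tau tau'"
  unfolding conj_pair_def by (rule exI[of _ 0], rule exI[of _ 1]) simp

lemma conj_pair_add:
  assumes "conj_pair x x'" "conj_pair y y'"
  shows "conj_pair (x + y) (x' + y')"
proof -
  obtain m n p q :: int where
    "x = m + n * tau" "x' = m + n * tau'" "y = p + q * tau" "y' = p + q * tau'"
    using assms unfolding conj_pair_def by blast
  then show ?thesis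
    unfolding conj_pair_def
    by (intro exI[of _ "m + p"] exI[of _ "n + q"]) (simp add: algebra_simps)
qed

lemma conj_pair_mult:
  assumes "conj_pair x x'" "conj_pair y y'"
  shows "conj_pair (x * y) (x' * y')"
proof -
  obtain m n p q :: int where
    eqs: "x = m + n * tau" "x' = m + n * tau'" "y = p + q * tau" "y' = p + q * tau'"
    using assms unfolding conj_pair_def by blast
  \<comment> \<open>One identity serves both embeddings, since \<open>tau\<close> and
    \<open>tau'\<close> are the roots of \<open>t * t = 1 + t\<close>.\<close>
  have expand: "(m + n * t) * (p + q * t) = (m * p + n * q) + (m * q + n * p + n * q) * t"
    if "t * t = 1 + t" for t :: real
    unfolding of_int_add of_int_mult using that by algebra
  show ?thesis
    unfolding conj_pair_def eqs
    using expand[OF tau_squared] expand[OF tau'_squared]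
    by (intro exI[of _ "m * p + n * q"] exI[of _ "m * q + n * p + n * q"]) simp
qed

lemma conj_pair_minus: "conj_pair x x' \<Longrightarrow> conj_pair (- x) (- x')"
  using conj_pair_mult[OF conj_pair_of_int[of "- 1"]] by simp

lemma conj_pair_diff:
  "conj_pair x x' \<Longrightarrow> conj_pair y y' \<Longrightarrow> conj_pair (x - y) (x' - y')"
  using conj_pair_add[OF _ conj_pair_minus] by simp

lemma conj_pair_power: "conj_pair x x' \<Longrightarrow> conj_pair (x ^ n) (x' ^ n)"
  by (induction n) (simp_all add: conj_pair_1 conj_pair_mult)

lemma conj_pair_unique: "conj_pair x y \<Longrightarrow> conj_pair x z \<Longrightarrow> y = z"
  unfolding conj_pair_def using Z_tau_repr_unique by blast

lemma conj_pair_eq_0_iff: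
  assumes "conj_pair x x'"
  shows "x' = 0 \<longleftrightarrow> x = 0"
proof
  assume "x' = 0"
  obtain m n :: int where mn: "x = m + n * tau" "x' = m + n * tau'"
    using assms unfolding conj_pair_def by blast
  \<comment> \<open>As \<open>tau' = 1 - tau\<close>, the vanishing of \<open>x'\<close> becomes a
    representation of 0 by 1 and \<open>tau\<close>.\<close>
  have "real_of_int (m + n) + of_int (- n) * tau = of_int 0 + of_int 0 * tau"
    using mn(2) \<open>x' = 0\<close> by (simp add: tau'_eq algebra_simps)
  then show "x = 0"
    using Z_tau_repr_unique mn(1) by fastforce
next
  assume "x = 0"
  then show "x' = 0"
    using assms conj_pair_unique conj_pair_of_int[of 0] by auto
qed

lemma conj_pair_trace:
  assumes "conj_pair x x'"
  shows "\<exists>t :: int. x + x' = of_int t"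
proof -
  obtain m n :: int where "x = m + n * tau" "x' = m + n * tau'"
    using assms unfolding conj_pair_def by blast
  then have "x + x' = of_int (2 * m + n)"
    by (simp add: tau'_eq algebra_simps)
  then show ?thesis by blast
qed

lemma conj_pair_norm:
  assumes "conj_pair x x'"
  shows "\<exists>t :: int. x * x' = of_int t"
proof -
  obtain m n :: int where eqs: "x = m + n * tau" "x' = m + n * tau'"
    using assms unfolding conj_pair_def by blast
  have "x * x' = of_int (m * m + m * n - n * n)"
    unfolding eqs of_int_add of_int_mult of_int_diff
    using tau_mult_tau' tau_add_tau' by algebra
  then show ?thesis by blast
qed

lemma conj_pair_norm_ge_1:
  assumes "conj_pair x x'" "x \<noteq> 0"
  shows "1 \<le> \<bar>x\<bar> * \<bar>x'\<bar>"
proof -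
  obtain t :: int where t: "x * x' = of_int t"
    using conj_pair_norm assms(1) by blast
  have "t \<noteq> 0"
    using t assms conj_pair_eq_0_iff by auto
  then have "1 \<le> \<bar>t\<bar>" by simp
  then have "(1::real) \<le> of_int \<bar>t\<bar>" by linarith
  also have "\<dots> = \<bar>x\<bar> * \<bar>x'\<bar>" using t by (simp add: abs_mult[symmetric])
  finally show ?thesis .
qed

section \<open>The model set and powers of \<open>tau\<close> through conjugates\<close>

lemma Z_tau_conj_pair: "x \<in> Z_tau \<Longrightarrow> \<exists>x'. conj_pair x x'"
  unfolding Z_tau_def conj_pair_def by blast

lemma conj_pair_mem_fib_model_set_iff:
  assumes "conj_pair x x'"
  shows "x \<in> fib_model_set \<longleftrightarrow> - 1 \<le> x' \<and> x' < tau - 1"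
proof -
  obtain m n :: int where "x = m + n * tau" "x' = m + n * tau'"
    using assms unfolding conj_pair_def by blast
  then have "x \<in> Z_tau" "galois_conj x = x'"
    unfolding Z_tau_def using galois_conj_eq by auto
  then show ?thesis by (simp add: fib_model_set_def)
qed

lemma conj_pair_tau_powi: "conj_pair (tau powi n) (tau' powi n)"
proof (cases "n \<ge> 0")
  case True
  then show ?thesis by (simp add: power_int_def conj_pair_power conj_pair_tau)
next
  case False
  \<comment> \<open>Negative powers stay in the ring because \<open>tau\<close> has inverse
    \<open>- tau' = tau - 1\<close>.\<close>
  have "inverse tau = - tau'" "inverse tau' = - tau"
    using tau_mult_tau' by (auto intro!: inverse_unique simp: mult.commute)
  moreover have "conj_pair (- tau') (- tau)"
    using conj_pair_diff[OF conj_pair_tau conj_pair_1] by (simp add: tau'_eq)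
  ultimately show ?thesis
    using False by (simp add: power_int_def conj_pair_power)
qed

section \<open>Excluding the conjugate -1\<close>

text \<open>The cofactor comes with a conjugate, so it lies in the ring, and a power sum equal to 1
  makes \<open>x + y\<close> a unit.\<close>

lemma conj_pair_sum_dvd_odd_power_sum:
  assumes "conj_pair x x'" "conj_pair y y'"
  shows "\<exists>w w'. conj_pair w w' \<and> x ^ Suc (2 * j) + y ^ Suc (2 * j) = (x + y) * w"
proof (induction j)
  case 0
  then show ?case using conj_pair_1 by force
next
  case (Suc j)
  then obtain w w' where w: "conj_pair w w'"
    "x ^ Suc (2 * j) + y ^ Suc (2 * j) = (x + y) * w" by blast
  let ?v = "\<lambda>x y w. x ^ (2 * j + 2) + y ^ (2 * j + 2) - x * y * w"
  have "conj_pair (?v x y w) (?v x' y' w')"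
    by (intro conj_pair_diff conj_pair_add conj_pair_mult conj_pair_power assms w)
  moreover have "x ^ Suc (2 * Suc j) + y ^ Suc (2 * Suc j)
      = (x + y) * (x ^ (2 * j + 2) + y ^ (2 * j + 2))
        - x * y * (x ^ Suc (2 * j) + y ^ Suc (2 * j))"
    by (simp add: algebra_simps)
  then have "x ^ Suc (2 * Suc j) + y ^ Suc (2 * Suc j) = (x + y) * ?v x y w"
    unfolding w(2) by (simp add: algebra_simps)
  ultimately show ?case by blast
qed

lemma totally_positive_unit_conj_notin:
  assumes u: "conj_pair u u'" and w: "conj_pair w w'" and uw: "u * w = 1"
    and "0 < u" "1 < u'"
  shows "2 \<le> u'"
proof (rule ccontr)
  assume "\<not> 2 \<le> u'"
  have "conj_pair 1 (u' * w')"
    using conj_pair_mult[OF u w] uw by simp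
  then have uw': "u' * w' = 1"
    using conj_pair_1 conj_pair_unique by blast
  obtain p q t :: int where p: "u * u' = p" and q: "w * w' = q" and t: "u + u' = t"
    using u w conj_pair_norm conj_pair_trace by metis
  have "real_of_int (p * q) = (u * w) * (u' * w')"
    using p q by (simp add: algebra_simps)
  then have "p * q = 1" using uw uw' by (simp del: of_int_mult)
  moreover have "0 < real_of_int p"
    unfolding p[symmetric] using assms by simp
  ultimately have "p = 1" using zmult_eq_1_iff by auto
  then have norm1: "u * u' = 1" using p by simp
  \<comment> \<open>Since \<open>u\<close> is the reciprocal of \<open>u'\<close>, this square
    bounds the trace below by 2; the next product bounds it above by 3, which suffices for an
    integer.\<close>
  have "0 < (u' - 1) * (u' - 1)" using \<open>1 < u'\<close> by simp
  then have "u' * 2 < u' * (u + u')" using norm1 by (simp add: algebra_simps)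
  then have "2 < u + u'" using \<open>1 < u'\<close> by simp
  moreover have "(u' - 1) * (u' - 2) < 0"
    using \<open>1 < u'\<close> \<open>\<not> 2 \<le> u'\<close> by (simp add: mult_less_0_iff)
  then have "u' * (u + u') < u' * 3" using norm1 by (simp add: algebra_simps)
  then have "u + u' < 3" using \<open>1 < u'\<close> by simp
  ultimately have "2 < t" "t < 3" using t by simp_all
  then show False by simp
qed

lemma conj_pair_odd_power_sum_neq_1:
  assumes x: "conj_pair x x'" and y: "conj_pair y y'"
    and nz: "x \<noteq> 0" "y \<noteq> 0" and "odd k" "2 \<le> k" and le: "x' \<le> 1" "y' \<le> 1"
  shows "x ^ k + y ^ k \<noteq> 1"
proof
  assume sum: "x ^ k + y ^ k = 1"
  have "conj_pair 1 (x' ^ k + y' ^ k)"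
    using conj_pair_add[OF conj_pair_power[OF x, of k] conj_pair_power[OF y, of k]] sum by simp
  then have sum': "x' ^ k + y' ^ k = 1"
    using conj_pair_1 conj_pair_unique by blast
  have nz': "x' \<noteq> 0" "y' \<noteq> 0"
    using nz x y conj_pair_eq_0_iff by auto
  \<comment> \<open>Two numbers at most 1 with sum 1 are both nonnegative; as \<open>k\<close> is
    odd, the bases inherit the sign.\<close>
  have "x' ^ k \<le> 1" "y' ^ k \<le> 1"
    using power_mono_odd[OF \<open>odd k\<close>] le by (metis power_one)+
  then have "0 \<le> x' ^ k" "0 \<le> y' ^ k" using sum' by simp_all
  then have pos: "0 < x'" "0 < y'"
    using \<open>odd k\<close> nz' by (auto simp: zero_le_odd_power)
  then have "x' ^ k < 1" "y' ^ k < 1"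
    using sum' zero_less_power[OF pos(1), of k] zero_less_power[OF pos(2), of k] by linarith+
  then have lt: "x' < 1" "y' < 1"
    using le by (auto simp: less_le)
  \<comment> \<open>Here \<open>k \<ge> 2\<close> enters: powers shrink on (0, 1), so
    \<open>x' + y'\<close> exceeds 1.\<close>
  have "x' ^ k < x'" "y' ^ k < y'"
    using power_strict_decreasing[of 1 k] pos lt \<open>2 \<le> k\<close> by force+
  then have "1 < x' + y'" using sum' by simp
  \<comment> \<open>In this embedding only the sign is needed, and monotonicity of odd powers gives
    it.\<close>
  moreover have "0 < x + y"
  proof (rule ccontr)
    assume "\<not> 0 < x + y"
    then have "x ^ k \<le> (- y) ^ k" using \<open>odd k\<close> by (intro power_mono_odd) auto
    then show False using sum \<open>odd k\<close> by simp
  qed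
  moreover obtain j where "k = Suc (2 * j)" using \<open>odd k\<close> by (auto elim: oddE)
  then obtain w w' where "conj_pair w w'" "(x + y) * w = 1"
    using conj_pair_sum_dvd_odd_power_sum[OF x y, of j] sum by metis
  ultimately have "2 \<le> x' + y'"
    using totally_positive_unit_conj_notin conj_pair_add[OF x y] by blast
  then show False using lt by simp
qed

lemma abs_less_1_if_even_power_sum_eq_1:
  fixes x y :: real
  assumes "even k" "x ^ k + y ^ k = 1" "y \<noteq> 0"
  shows "\<bar>x\<bar> < 1"
proof (rule ccontr)
  assume "\<not> \<bar>x\<bar> < 1"
  then have "1 \<le> \<bar>x\<bar> ^ k" by simp
  moreover have "0 < y ^ k" using assms by (simp add: zero_less_power_eq)
  ultimately show False using assms by (simp add: power_even_abs)
qed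

text \<open>For even \<open>k\<close> the conjugate equation would force \<open>c' ^ k > 1\<close>;
  for odd \<open>k\<close>, moving \<open>c\<close> across gives two odd powers with sum 1.\<close>

lemma fermat_conj_summand_neq_minus_1:
  assumes a: "conj_pair a a'" and b: "conj_pair b b'" and c: "conj_pair c c'"
    and nz: "b \<noteq> 0" "c \<noteq> 0" and "2 \<le> k" and eq: "a ^ k + b ^ k = c ^ k"
    and "b' \<le> 1" "\<bar>c'\<bar> \<le> 1"
  shows "a' \<noteq> - 1"
proof
  assume "a' = - 1"
  have "a + 1 = 0"
    using conj_pair_eq_0_iff[OF conj_pair_add[OF a conj_pair_1]] \<open>a' = - 1\<close> by simp
  then have "a = - 1" by simp
  show False
  proof (cases "even k")
    case True
    have "conj_pair (c ^ k) (a' ^ k + b' ^ k)"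
      using conj_pair_add[OF conj_pair_power[OF a, of k] conj_pair_power[OF b, of k]] eq by simp
    then have "a' ^ k + b' ^ k = c' ^ k"
      using conj_pair_power[OF c] conj_pair_unique by blast
    then have "1 + b' ^ k = c' ^ k" using True \<open>a' = - 1\<close> by simp
    moreover have "\<bar>c'\<bar> ^ k \<le> 1" using \<open>\<bar>c'\<bar> \<le> 1\<close> by (simp add: power_le_one)
    moreover have "b' \<noteq> 0" using nz b conj_pair_eq_0_iff by simp
    then have "0 < b' ^ k" using True by (simp add: zero_less_power_eq)
    ultimately show False using True by (simp add: power_even_abs)
  next
    case False
    then have "b ^ k + (- c) ^ k = 1" using eq \<open>a = - 1\<close> by simp
    then show False
      using conj_pair_odd_power_sum_neq_1[OF b conj_pair_minus[OF c]] assms False by auto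
  qed
qed

text \<open>For even \<open>k\<close> both embeddings of \<open>a\<close> would be smaller than 1 in
  size, contradicting its norm; for odd \<open>k\<close> negation gives two odd powers with sum
  1.\<close>

lemma fermat_conj_sum_neq_minus_1:
  assumes a: "conj_pair a a'" and b: "conj_pair b b'" and c: "conj_pair c c'"
    and nz: "a \<noteq> 0" "b \<noteq> 0" and "2 \<le> k" and eq: "a ^ k + b ^ k = c ^ k"
    and "- 1 \<le> a'" "- 1 \<le> b'"
  shows "c' \<noteq> - 1"
proof
  assume "c' = - 1"
  have "c + 1 = 0"
    using conj_pair_eq_0_iff[OF conj_pair_add[OF c conj_pair_1]] \<open>c' = - 1\<close> by simp
  then have "c = - 1" by simp
  show False
  proof (cases "even k")
    case True
    have sum: "a ^ k + b ^ k = 1" using eq \<open>c = - 1\<close> True by simp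
    have "conj_pair 1 (a' ^ k + b' ^ k)"
      using conj_pair_add[OF conj_pair_power[OF a, of k] conj_pair_power[OF b, of k]] sum by simp
    then have sum': "a' ^ k + b' ^ k = 1"
      using conj_pair_1 conj_pair_unique by blast
    have "b' \<noteq> 0" using nz b conj_pair_eq_0_iff by simp
    have "\<bar>a\<bar> < 1" "\<bar>a'\<bar> < 1"
      using abs_less_1_if_even_power_sum_eq_1 True sum sum' nz \<open>b' \<noteq> 0\<close> by blast+
    then have "\<bar>a\<bar> * \<bar>a'\<bar> < 1 * 1" by (intro mult_strict_mono') auto
    then show False using conj_pair_norm_ge_1[OF a nz(1)] by simp
  next
    case False
    then have "(- a) ^ k + (- b) ^ k = 1" using eq \<open>c = - 1\<close> by simp
    then show False
      using conj_pair_odd_power_sum_neq_1[OF conj_pair_minus[OF a] conj_pair_minus[OF b]]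
        assms False by auto
  qed
qed

section \<open>Multiplication by \<open>tau\<close> inside the model set\<close>

lemma window_mult_tau':
  assumes "- 1 < x" "x < tau - 1"
  shows "- 1 \<le> x * tau'" "x * tau' < tau - 1"
proof -
  have *: "0 < tau - 1" "tau - 1 < 1" using tau_gt_1 tau_less_2 by simp_all
  \<comment> \<open>The crude bound \<open>x < 1\<close> is enough at the lower end.\<close>
  have "(tau - 1) * x < (tau - 1) * 1" using * assms by (intro mult_strict_left_mono) auto
  then show "- 1 \<le> x * tau'" using * by (simp add: tau'_eq algebra_simps)
  \<comment> \<open>At the upper end there is no slack: \<open>x = -1\<close> would land exactly on
    \<open>tau - 1\<close>.\<close>
  have "(tau - 1) * (- 1) < (tau - 1) * x" using * assms by (intro mult_strict_left_mono) auto
  then show "x * tau' < tau - 1" by (simp add: tau'_eq algebra_simps)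
qed

lemma fermat_fib_model_set_step:
  assumes "k \<ge> 2" and nz: "a \<noteq> 0" "b \<noteq> 0" "c \<noteq> 0" and eq: "a ^ k + b ^ k = c ^ k"
    and mem: "a \<in> fib_model_set" "b \<in> fib_model_set" "c \<in> fib_model_set"
  shows "a * tau \<in> fib_model_set \<and> b * tau \<in> fib_model_set \<and> c * tau \<in> fib_model_set"
proof -
  obtain a' b' c' where a: "conj_pair a a'" and b: "conj_pair b b'" and c: "conj_pair c c'"
    using mem Z_tau_conj_pair unfolding fib_model_set_def by blast
  note bounds = mem[unfolded a[THEN conj_pair_mem_fib_model_set_iff]
      b[THEN conj_pair_mem_fib_model_set_iff] c[THEN conj_pair_mem_fib_model_set_iff]]
  have eq': "b ^ k + a ^ k = c ^ k" using eq by simp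
  have "a' \<noteq> - 1"
    by (rule fermat_conj_summand_neq_minus_1[OF a b c nz(2,3) \<open>k \<ge> 2\<close> eq])
      (use bounds tau_less_2 in auto)
  moreover have "b' \<noteq> - 1"
    by (rule fermat_conj_summand_neq_minus_1[OF b a c nz(1,3) \<open>k \<ge> 2\<close> eq'])
      (use bounds tau_less_2 in auto)
  moreover have "c' \<noteq> - 1"
    by (rule fermat_conj_sum_neq_minus_1[OF a b c nz(1,2) \<open>k \<ge> 2\<close> eq]) (use bounds in auto)
  moreover have "x * tau \<in> fib_model_set"
    if "conj_pair x x'" "- 1 \<le> x' \<and> x' < tau - 1" "x' \<noteq> - 1" for x x'
    using conj_pair_mem_fib_model_set_iff[OF conj_pair_mult[OF that(1) conj_pair_tau]]
      window_mult_tau'[of x'] that by auto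
  ultimately show ?thesis using a b c bounds by blast
qed

section \<open>Large and small exponents\<close>

lemma abs_tau'_powi: "\<bar>tau' powi n\<bar> = (tau - 1) powi n"
  using tau_gt_1 by (simp add: power_int_abs tau'_eq)

lemma eventually_mem_fib_model_set:
  assumes "x \<in> Z_tau"
  shows "\<forall>\<^sub>F n :: nat in sequentially. x * tau powi int n \<in> fib_model_set"
proof -
  obtain x' where x: "conj_pair x x'" using assms Z_tau_conj_pair by blast
  have "(\<lambda>n. x' * tau' ^ n) \<longlonglongrightarrow> x' * 0"
    using tau_gt_1 tau_less_2 by (intro tendsto_intros LIMSEQ_power_zero) (simp add: tau'_eq)
  \<comment> \<open>The radius \<open>tau - 1\<close> is below 1, so this ball about 0 fits into the
    window.\<close>
  then have "\<forall>\<^sub>F n in sequentially. dist (x' * tau' ^ n) 0 < tau - 1"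
    using tau_gt_1 by (intro tendstoD) auto
  then show ?thesis
  proof eventually_elim
    case (elim n)
    then have "\<bar>x' * tau' powi int n\<bar> < tau - 1" by simp
    then show ?case
      unfolding conj_pair_mem_fib_model_set_iff[OF conj_pair_mult[OF x conj_pair_tau_powi]]
      using tau_less_2 by linarith
  qed
qed

text \<open>The conjugate has size \<open>\<bar>x'\<bar> * (tau - 1) powi n\<close>, which grows
  past 1 as \<open>n\<close> decreases.\<close>

lemma mem_fib_model_set_bounded_below:
  assumes "x \<in> Z_tau" "x \<noteq> 0"
  shows "\<exists>M :: int. \<forall>n. x * tau powi n \<in> fib_model_set \<longrightarrow> M \<le> n"
proof -
  obtain x' where x: "conj_pair x x'" using assms Z_tau_conj_pair by blast
  have "0 < \<bar>x'\<bar>" using assms x conj_pair_eq_0_iff by auto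
  then obtain j where j: "(tau - 1) ^ j < \<bar>x'\<bar>"
    using real_arch_pow_inv[of "\<bar>x'\<bar>" "tau - 1"] tau_less_2 by auto
  have "- int j \<le> n" if "x * tau powi n \<in> fib_model_set" for n
  proof (rule ccontr)
    assume "\<not> - int j \<le> n"
    then have "j \<le> nat (- n)" "n < 0" by auto
    have pos: "0 < (tau - 1) ^ nat (- n)" using tau_gt_1 by simp
    have "\<bar>x' * tau' powi n\<bar> \<le> 1"
      using that tau_less_2
      unfolding conj_pair_mem_fib_model_set_iff[OF conj_pair_mult[OF x conj_pair_tau_powi]]
      by auto
    then have "\<bar>x'\<bar> * inverse ((tau - 1) ^ nat (- n)) \<le> 1"
      using \<open>n < 0\<close> unfolding abs_mult abs_tau'_powi by (simp add: power_int_def power_inverse)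
    then have "\<bar>x'\<bar> \<le> (tau - 1) ^ nat (- n)" using pos by (simp add: field_simps)
    also have "\<dots> \<le> (tau - 1) ^ j"
      using tau_gt_1 tau_less_2 \<open>j \<le> nat (- n)\<close> by (intro power_decreasing) auto
    finally show False using j by simp
  qed
  then show ?thesis by blast
qed

section \<open>The threshold\<close>

lemma int_upward_closed_eq_atLeast:
  fixes P :: "int \<Rightarrow> bool"
  assumes "P m" and step: "\<And>n. P n \<Longrightarrow> P (n + 1)" and low: "\<And>n. P n \<Longrightarrow> M \<le> n"
  shows "\<exists>N. \<forall>n. P n \<longleftrightarrow> N \<le> n"
proof -
  \<comment> \<open>Counting from the lower bound \<open>M\<close> turns the minimum over integers
    into a \<open>LEAST\<close> over naturals.\<close>
  define j where "j = (LEAST j. P (M + int j))"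
  have "P (M + int (nat (m - M)))" using assms(1) low[OF assms(1)] by simp
  then have base: "P (M + int j)" unfolding j_def by (rule LeastI)
  have "P n" if "M + int j \<le> n" for n
    using that by (induction rule: int_ge_induct) (auto intro: base step)
  moreover have "M + int j \<le> n" if "P n" for n
  proof -
    have "P (M + int (nat (n - M)))" using that low[OF that] by simp
    then have "j \<le> nat (n - M)" unfolding j_def by (rule Least_le)
    then show ?thesis using low[OF that] by simp
  qed
  ultimately show ?thesis by blast
qed

theorem theorem4p6:
  fixes k :: nat and a b c :: real
  assumes "k \<ge> 2"
    and "a \<in> Z_tau - {0}" and "b \<in> Z_tau - {0}" and "c \<in> Z_tau - {0}"
    and "a ^ k + b ^ k = c ^ k"
  shows "\<exists>N :: int. \<forall>n :: int.
           (a * tau powi n \<in> fib_model_set \<and> b * tau powi n \<in> fib_model_set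
              \<and> c * tau powi n \<in> fib_model_set) \<longleftrightarrow> n \<ge> N"
proof -
  let ?P = "\<lambda>n. a * tau powi n \<in> fib_model_set \<and> b * tau powi n \<in> fib_model_set
              \<and> c * tau powi n \<in> fib_model_set"
  have "tau \<noteq> 0" using tau_gt_1 by simp
  have "\<forall>\<^sub>F n :: nat in sequentially. ?P (int n)"
    using assms by (intro eventually_conj eventually_mem_fib_model_set) auto
  then obtain m :: nat where "?P (int m)"
    unfolding eventually_sequentially by blast
  moreover have "?P (n + 1)" if "?P n" for n
  proof -
    \<comment> \<open>The equation is homogeneous, so the scaled elements again form a Fermat
      triple.\<close>
    have "(a * tau powi n) ^ k + (b * tau powi n) ^ k = (c * tau powi n) ^ k"
      unfolding power_mult_distrib assms(5)[symmetric] by (rule distrib_right[symmetric])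
    then show ?thesis
      using fermat_fib_model_set_step[OF assms(1), of "a * tau powi n" "b * tau powi n"
          "c * tau powi n"] that assms \<open>tau \<noteq> 0\<close>
      by (simp add: power_int_add mult.assoc)
  qed
  \<comment> \<open>A lower bound for \<open>a\<close> alone already bounds the exponents of the
    triple.\<close>
  moreover obtain M where "\<forall>n. a * tau powi n \<in> fib_model_set \<longrightarrow> M \<le> n"
    using mem_fib_model_set_bounded_below assms by blast
  ultimately show ?thesis
    using int_upward_closed_eq_atLeast[of ?P "int m" M] by blast
qed

end
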